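(* Let $\psi(a,c,x)$ denote the Tricomi confluent hypergeometric function of the second kind. (i) If $a>0>c$ and $x>0$, then $$\frac{1}{1+a-c}\left(1+\frac{1}{2c}x\right)\psi^2(a,c,x)<\psi^2(a,c,x)-\psi(a-1,c,x)\psi(a+1,c,x)<\frac{2}{x}\psi^2(a,c,x).$$ Moreover, the right-hand inequality $$\psi^2(a,c,x)-\psi(a-1,c,x)\psi(a+1,c,x)<\frac{2}{x}\psi^2(a,c,x)$$ holds for all $a>0$, $c<1$ and $x>0$. (ii) If $a>1$, $c<-1$ and $x>0$, then $$\frac{1}{1+a-c}\left(1-\left(\frac{c-a}{c^2(c+1)}\right)x^2\right)\psi^2(a,c,x)<\psi^2(a,c,x)-\psi(a-1,c,x)\psi(a+1,c,x).$$ The left-hand inequality in (i) and the inequality in (ii) are sharp as $x\to 0$ (from the right), and the right-hand inequality in (i) is sharp as $x\to\infty$, where "sharp" means that, after dividing by $\psi^2(a,c,x)$, the two sides of the inequality have the same finite limit as $x$ tends to the indicated endpoint.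
   Context: For real $a,c$ and $x>0$, $\psi(a,c,x)$ is the Tricomi confluent hypergeometric function of the second kind (often written $U(a,c,x)$): the particular solution on $(0,\infty)$ of Kummer's differential equation $xy''(x)+(c-x)y'(x)-ay(x)=0$ characterized by $x^{a}\psi(a,c,x)\to 1$ as $x\to\infty$. For $a>0$, $c\in\mathbb{R}$, $x>0$ it has the integral representation $$\psi(a,c,x)=\frac{1}{\Gamma(a)}\int_{0}^{\infty}e^{-xt}t^{a-1}(1+t)^{c-a-1}\,dt.$$ Notation: $\psi^2(a,c,x)=(\psi(a,c,x))^2$. *)

theory Defs
  imports Complex_Main
begin

definition kummer_solution :: "real \<Rightarrow> real \<Rightarrow> (real \<Rightarrow> real) \<Rightarrow> bool" where
  "kummer_solution a c y \<longleftrightarrow>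
     (\<exists>y' y''. \<forall>x>0. (y has_real_derivative y' x) (at x) \<and>
                     (y' has_real_derivative y'' x) (at x) \<and>
                     x * y'' x + (c - x) * y' x - a * y x = 0)"

(* For all real a, c exactly one solution on (0,\<infinity>) satisfies x^a y(x) \<longrightarrow> 1: any solution
   independent of it grows like exp(x) x^(a-c). The value 0 at x \<le> 0 is a convention that
   makes the total function unique. *)
definition tricomi :: "real \<Rightarrow> real \<Rightarrow> real \<Rightarrow> real" where
  "tricomi a c =
     (THE y. kummer_solution a c y \<and> ((\<lambda>x. x powr a * y x) \<longlongrightarrow> 1) at_top \<and> (\<forall>x\<le>0. y x = 0))"

(* Sharpness of an inequality between f and g along the filter F, relative to the weight w. *)
definition sharp_relative :: "(real \<Rightarrow> real) \<Rightarrow> (real \<Rightarrow> real) \<Rightarrow> (real \<Rightarrow> real) \<Rightarrow> real filter \<Rightarrow> bool" where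
  "sharp_relative w f g F \<longleftrightarrow>
     (\<exists>L. ((\<lambda>x. f x / w x) \<longlongrightarrow> L) F \<and> ((\<lambda>x. g x / w x) \<longlongrightarrow> L) F)"

end

(* Put b = 1 + a - c and let J(a,b,x) be the integral of exp(-x t) t^(a-1) (1+t)^(-b) over t > 0.
   Integration by parts shows that J(a,b,.) / Gamma(a) solves Kummer's equation, and
   1 - b t <= (1+t)^(-b) <= 1 gives its behaviour at infinity. It is psi(a,c,.) by uniqueness: the
   quotient y/z of two admissible solutions has derivative K x^(-c) exp(x) / z^2, which forces K = 0.
   With p = -psi'/psi and v = -x p', the contiguous relations turn the quotient of the Turanian by
   psi^2 into (1 - x v / a) / b. Kummer's equation becomes a Riccati equation for p and yields
   a differential equation for v, so every bound to be proved reads d > 0 for a function d with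
   a nonnegative limit at infinity and x d' = delta + m d, where delta < 0 <= m; such a d cannot
   become nonpositive. *)
theory Submission
  imports Defs "HOL-Analysis.Analysis" "HOL-Real_Asymp.Real_Asymp"
begin

text \<open>Because \<open>tricomi\<close> is a definite description, each of psi(a-1,c,.),
  psi(a,c,.) and psi(a+1,c,.) has to be recognised through existence and uniqueness. The integral
  represents psi only for a positive first parameter, and a - 1 may be negative or zero; the lower
  neighbour is therefore built from psi(a,c,.) by a contiguous relation. The barrier runs from
  infinity because p and v tend to 0 there for all admissible parameters, whereas the expansion of
  psi at 0 depends on c and may contain logarithms. The constants for c < 0 nevertheless come from
  the point 0: setting x = 0 and v = 0 in v = a - (x - c) p - x p^2 gives p = a / (-c), and the
  equation for v then gives the slope of v at 0 when c < -1. The 2 in 2/x counts two quantities,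
  each below 1/x: the quotient psi(a+1)/psi(a) = (a - x p)/(a b), and x (p - v)/(a b), where p - v
  is the derivative of x p.\<close>

section \<open>Laplace-type integrals: recurrences, derivative, behaviour at infinity\<close>

lemma has_bochner_integral_Gamma:
  fixes a x :: real
  assumes "a > 0" "x > 0"
  shows "has_bochner_integral lborel (\<lambda>t. indicator {0<..} t *\<^sub>R (exp (-x*t) * t powr (a-1)))
           (Gamma a * x powr (-a))"
proof -
  let ?g = "\<lambda>t::real. indicator {0<..} t * (exp (-t) * t powr (a-1))"
  have eq: "(\<integral>\<^sup>+t. ?g t \<partial>lborel) = ennreal (Gamma a)"
    unfolding Gamma_conv_nn_integral_real[OF assms(1)]
    by (intro nn_integral_cong) (auto split: split_indicator simp: exp_minus field_simps)
  have g: "has_bochner_integral lborel ?g (Gamma a)"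
    by (rule has_bochner_integral_nn_integral) (use eq Gamma_real_pos[OF assms(1)] in auto)
  \<comment> \<open>Euler's integral is rescaled by \<open>x * t\<close>; the factor
    \<open>x powr (1-a)\<close> then removes the surplus power of \<open>x\<close> from
    \<open>(x * t) powr (a-1)\<close>.\<close>
  have "has_bochner_integral lborel (\<lambda>t. ?g (0 + x * t)) (Gamma a /\<^sub>R \<bar>x\<bar>)"
    using g assms by (subst (asm) lborel_has_bochner_integral_real_affine_iff[of x _ _ 0]) auto
  then have A: "has_bochner_integral lborel (\<lambda>t. x powr (1-a) * ?g (0 + x * t)) (x powr (1-a) * (Gamma a /\<^sub>R \<bar>x\<bar>))"
    by (rule has_bochner_integral_mult_right)
  have B: "x powr (1-a) * (Gamma a /\<^sub>R \<bar>x\<bar>) = Gamma a * x powr (-a)"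
    using assms by (simp add: powr_diff powr_minus field_simps)
  have C: "x powr (1-a) * ?g (0 + x * t) = indicator {0<..} t *\<^sub>R (exp (-x*t) * t powr (a-1))" for t
    using assms by (auto simp: powr_mult powr_diff field_simps zero_less_mult_iff split: split_indicator)
  show ?thesis using A unfolding B C .
qed

text \<open>The second parameter is kept free instead of being tied to c, because the recurrences
  move \<open>a\<close> and \<open>b\<close> independently: a factor \<open>t\<close> raises
  \<open>a\<close>, a division by \<open>1+t\<close> raises \<open>b\<close>.\<close>

definition tricomi_kernel :: "real \<Rightarrow> real \<Rightarrow> real \<Rightarrow> real \<Rightarrow> real" where
  "tricomi_kernel a b x t = exp (-x*t) * t powr (a-1) * (1+t) powr (-b)"

definition tricomi_integral :: "real \<Rightarrow> real \<Rightarrow> real \<Rightarrow> real" where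
  "tricomi_integral a b x = (LINT t:{0<..}|lborel. tricomi_kernel a b x t)"

lemma Gamma_set_integral:
  fixes a x :: real
  assumes "a > 0" "x > 0"
  shows "set_integrable lborel {0<..} (\<lambda>t. exp (-x*t) * t powr (a-1))"
    and "(LINT t:{0<..}|lborel. exp (-x*t) * t powr (a-1)) = Gamma a * x powr (-a)"
  using has_bochner_integral_Gamma[OF assms]
  unfolding set_integrable_def set_lebesgue_integral_def has_bochner_integral_iff by auto

lemma tricomi_kernel_measurable [measurable]: "tricomi_kernel a b x \<in> borel_measurable borel"
  unfolding tricomi_kernel_def by measurable

text \<open>The lower bound is Bernoulli's inequality through the exponential: (1+t)^(-b) = exp(-b
  ln(1+t)) \<ge> 1 - b ln(1+t), and ln(1+t) \<le> t. It remains valid where 1 - b t is negative, so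
  it can be integrated over the whole half-line.\<close>

lemma tricomi_kernel_bounds:
  assumes "b \<ge> 0" "t > 0"
  shows "0 < tricomi_kernel a b x t" "tricomi_kernel a b x t \<le> exp (-x*t) * t powr (a-1)"
    and "(1 - b * t) * (exp (-x*t) * t powr (a-1)) \<le> tricomi_kernel a b x t"
proof -
  have "1 - b * t \<le> 1 - b * ln (1+t)"
    using assms ln_add_one_self_le_self[of t] by (simp add: mult_left_mono)
  also have "\<dots> \<le> exp (- b * ln (1+t))"
    using exp_ge_add_one_self[of "- b * ln (1+t)"] by simp
  also have "\<dots> = (1+t) powr (-b)" using assms by (simp add: powr_def)
  finally have l: "1 - b * t \<le> (1+t) powr (-b)" .
  have u: "(1+t) powr (-b) \<le> 1"
    using assms powr_mono[of "-b" 0 "1+t"] by simp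
  show "0 < tricomi_kernel a b x t" using assms by (simp add: tricomi_kernel_def)
  show "tricomi_kernel a b x t \<le> exp (-x*t) * t powr (a-1)"
    using u by (simp add: tricomi_kernel_def mult_left_le)
  show "(1 - b * t) * (exp (-x*t) * t powr (a-1)) \<le> tricomi_kernel a b x t"
    using mult_right_mono[OF l, of "exp (-x*t) * t powr (a-1)"]
    by (simp add: tricomi_kernel_def mult_ac)
qed

lemma tricomi_kernel_integrable:
  assumes "a > 0" "b \<ge> 0" "x > 0"
  shows "set_integrable lborel {0<..} (tricomi_kernel a b x)"
proof (rule set_integrable_bound[OF Gamma_set_integral(1)[OF assms(1,3)]])
  show "set_borel_measurable lborel {0<..} (tricomi_kernel a b x)"
    unfolding set_borel_measurable_def by measurable
  show "AE t in lborel. t \<in> {0<..} \<longrightarrow> norm (tricomi_kernel a b x t) \<le> norm (exp (-x*t) * t powr (a-1))"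
    using tricomi_kernel_bounds(1,2)[OF assms(2), where a = a and x = x]
    by (intro AE_I2) (auto simp: less_imp_le)
qed

text \<open>A vanishing integral of a positive kernel would make the half-line a null set, although
  it contains an interval of length 1.\<close>

lemma tricomi_integral_pos:
  assumes "a > 0" "b \<ge> 0" "x > 0"
  shows "tricomi_integral a b x > 0"
proof -
  have "0 \<le> tricomi_integral a b x"
    unfolding tricomi_integral_def set_lebesgue_integral_def
    by (intro integral_nonneg_AE AE_I2)
       (use tricomi_kernel_bounds(1)[OF assms(2)] in \<open>auto simp: less_imp_le split: split_indicator\<close>)
  moreover have "tricomi_integral a b x \<noteq> 0"
  proof
    assume "tricomi_integral a b x = 0"
    then have "AE t in lborel. indicator {0<..} t *\<^sub>R tricomi_kernel a b x t = 0"
      using tricomi_kernel_integrable[OF assms] tricomi_kernel_bounds(1)[OF assms(2)]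
      unfolding tricomi_integral_def set_lebesgue_integral_def set_integrable_def
      by (subst (asm) integral_nonneg_eq_0_iff_AE)
         (auto simp: less_imp_le intro!: AE_I2 split: split_indicator)
    then have "AE t::real in lborel. t \<notin> {0<..}"
    proof (rule eventually_mono)
      fix t :: real assume "indicator {0<..} t *\<^sub>R tricomi_kernel a b x t = 0"
      then show "t \<notin> {0<..}"
        using tricomi_kernel_bounds(1)[OF assms(2), of t a x] by (auto simp: indicator_def split: if_splits)
    qed
    then have "emeasure lborel {0::real<..} = 0"
      by (subst (asm) AE_iff_measurable[of "{0<..}"]) auto
    moreover have "{1..2::real} \<subseteq> {0<..}" by auto
    ultimately have "emeasure lborel {1..2::real} = 0"
      using emeasure_mono[of "{1..2::real}" "{0<..}" lborel] by simp
    then show False by simp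
  qed
  ultimately show ?thesis by simp
qed

text \<open>Write (1+t)^(-b) as (1+t) (1+t)^(-b-1) and multiply out.\<close>

lemma tricomi_integral_split:
  assumes "a > 0" "b \<ge> 0" "x > 0"
  shows "tricomi_integral a b x = tricomi_integral a (b+1) x + tricomi_integral (a+1) (b+1) x"
proof -
  have "tricomi_kernel a (b+1) x t + tricomi_kernel (a+1) (b+1) x t = tricomi_kernel a b x t"
    if "t > 0" for t
  proof -
    have "t powr a = t * t powr (a-1)" "(1+t) powr (-b) = (1+t) * (1+t) powr (-(b+1))"
      using that by (simp_all add: powr_diff powr_minus powr_add divide_simps)
    then show ?thesis unfolding tricomi_kernel_def by (simp add: algebra_simps)
  qed
  then have "tricomi_integral a b x = (LINT t:{0<..}|lborel. tricomi_kernel a (b+1) x t + tricomi_kernel (a+1) (b+1) x t)"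
    unfolding tricomi_integral_def by (intro set_lebesgue_integral_cong) auto
  also have "\<dots> = tricomi_integral a (b+1) x + tricomi_integral (a+1) (b+1) x"
    unfolding tricomi_integral_def using assms by (intro set_integral_add tricomi_kernel_integrable) auto
  finally show "tricomi_integral a b x = tricomi_integral a (b+1) x + tricomi_integral (a+1) (b+1) x" .
qed

lemma tricomi_integral_strict_decreasing:
  assumes "a > 0" "b \<ge> 0" "x > 0"
  shows "tricomi_integral a (b+1) x < tricomi_integral a b x"
  unfolding tricomi_integral_split[OF assms] using tricomi_integral_pos[of "a+1" "b+1" x] assms by simp

text \<open>The integrand \<open>?f\<close> is the derivative of exp(-x t) t^a (1+t)^(-b), which
  vanishes at both ends since a > 0; so its integral is zero.\<close>

lemma tricomi_integral_by_parts:
  assumes "a > 0" "b \<ge> 0" "x > 0"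
  shows "x * tricomi_integral (a+1) b x = a * tricomi_integral a b x - b * tricomi_integral (a+1) (b+1) x"
proof -
  let ?f = "\<lambda>t. (a * tricomi_kernel a b x t - b * tricomi_kernel (a+1) (b+1) x t) - x * tricomi_kernel (a+1) b x t"
  let ?F = "tricomi_kernel (a+1) b x"
  have int: "set_integrable lborel {0<..} (\<lambda>t. a * tricomi_kernel a b x t)"
     "set_integrable lborel {0<..} (\<lambda>t. b * tricomi_kernel (a+1) (b+1) x t)"
     "set_integrable lborel {0<..} (\<lambda>t. x * tricomi_kernel (a+1) b x t)"
    using assms by (auto intro!: set_integrable_mult_right tricomi_kernel_integrable)
  have eint: "einterval 0 \<infinity> = {0<..}"
    by (auto simp: einterval_def)
  have "(LBINT t=0..\<infinity>. ?f t) = 0 - 0"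
  proof (rule interval_integral_FTC_integrable)
    fix t :: real assume "0 < ereal t"
    then have t: "t > 0" by simp
    have D: "(?F has_real_derivative
       -x * exp (-x*t) * t powr a * (1+t) powr (-b) + exp (-x*t) * (a * t powr (a-1)) * (1+t) powr (-b)
        + exp (-x*t) * t powr a * (-b * (1+t) powr (-b-1))) (at t)"
      (is "(_ has_real_derivative ?D) _")
      unfolding tricomi_kernel_def using t
      by (auto intro!: derivative_eq_intros simp: powr_diff algebra_simps)
    have "?D = ?f t"
      using arg_cong[of "- 1 - b" "- b - 1" "(powr) (1+t)"] by (simp add: tricomi_kernel_def algebra_simps)
    then show "(?F has_vector_derivative ?f t) (at t)"
      using D by (simp add: has_real_derivative_iff_has_vector_derivative)
    show "isCont ?f t" unfolding tricomi_kernel_def using t by (intro continuous_intros) auto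
  next
    show "set_integrable lborel (einterval 0 \<infinity>) ?f" unfolding eint using int by auto
    have "(?F \<longlongrightarrow> 0) (at_right 0)"
      unfolding tricomi_kernel_def using assms by real_asymp
    then show "((?F \<circ> real_of_ereal) \<longlongrightarrow> 0) (at_right 0)"
      by (simp add: zero_ereal_def ereal_tendsto_simps)
    have "(?F \<longlongrightarrow> 0) at_top"
      unfolding tricomi_kernel_def using assms by real_asymp
    then show "((?F \<circ> real_of_ereal) \<longlongrightarrow> 0) (at_left \<infinity>)"
      by (simp add: ereal_tendsto_simps)
  qed simp
  then have "(LINT t:{0<..}|lborel. ?f t) = 0"
    by (simp add: interval_lebesgue_integral_def eint)
  also have "(LINT t:{0<..}|lborel. ?f t) = a * tricomi_integral a b x - b * tricomi_integral (a+1) (b+1) x - x * tricomi_integral (a+1) b x"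
    unfolding tricomi_integral_def using int by simp
  finally show ?thesis by simp
qed

text \<open>A quadratic error bound replaces differentiation under the integral sign. The Taylor
  remainder of exp(-h t) is at most (h t)^2 exp(x t / 2) once \<bar>h\<bar> \<le> x/2. Half of the
  decay of exp(-x t) absorbs that exponential, and t^2 raises \<open>a\<close> by 2, which leaves
  the convergent integral at \<open>x/2\<close>.\<close>

lemma tricomi_integral_has_derivative:
  assumes "a > 0" "b \<ge> 0" "x > 0"
  shows "(tricomi_integral a b has_real_derivative - tricomi_integral (a+1) b x) (at x)"
proof -
  have bound: "\<bar>tricomi_integral a b (x+h) - tricomi_integral a b x + h * tricomi_integral (a+1) b x\<bar> \<le> h\<^sup>2 * tricomi_integral (a+2) b (x/2)"
    if h: "\<bar>h\<bar> \<le> x/2" for h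
  proof -
    let ?r = "\<lambda>t. tricomi_kernel a b (x+h) t - tricomi_kernel a b x t + h * tricomi_kernel (a+1) b x t"
    let ?g = "\<lambda>t. h\<^sup>2 * tricomi_kernel (a+2) b (x/2) t"
    have i: "set_integrable lborel {0<..} (tricomi_kernel a b (x+h))"
       "set_integrable lborel {0<..} (tricomi_kernel a b x)"
       "set_integrable lborel {0<..} (\<lambda>t. h * tricomi_kernel (a+1) b x t)"
       "set_integrable lborel {0<..} ?g"
      using assms h by (auto intro!: set_integrable_mult_right tricomi_kernel_integrable)
    have ri: "set_integrable lborel {0<..} ?r" using i by auto
    have p: "\<bar>?r t\<bar> \<le> ?g t" if t: "t > 0" for t
    proof -
      have ex: "\<bar>exp (-h*t) - 1 + h*t\<bar> \<le> (h*t)\<^sup>2 * exp (x/2*t)"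
      proof -
        have "\<exists>s. \<bar>s\<bar> \<le> \<bar>-h*t\<bar> \<and> exp (-h*t) = (\<Sum>m<2. (-h*t)^m / fact m) + exp s / fact 2 * (-h*t)^2"
          by (rule Maclaurin_exp_le)
        then obtain s where s: "\<bar>s\<bar> \<le> \<bar>-h*t\<bar>" "exp (-h*t) = (\<Sum>m<2. (-h*t)^m / fact m) + exp s / fact 2 * (-h*t)^2"
          by blast
        have "\<bar>-h*t\<bar> \<le> x/2*t" using h t by (simp add: abs_mult mult_right_mono)
        then have "s \<le> x/2*t" using s(1) by linarith
        then have "exp s \<le> exp (x/2*t)" by simp
        then have "exp s / 2 \<le> exp (x/2*t)" using exp_gt_zero[of s] by linarith
        moreover have "exp (-h*t) - 1 + h*t = exp s / 2 * (h*t)\<^sup>2"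
          using s(2) by (simp add: numeral_2_eq_2)
        ultimately show ?thesis
          using mult_right_mono[of "exp s / 2" "exp (x/2*t)" "(h*t)\<^sup>2"]
          by (simp only: abs_mult abs_divide abs_exp_cancel abs_power2 abs_numeral zero_le_power2 mult.commute[of "(h*t)\<^sup>2"])
      qed
      have "exp (-(x+h)*t) = exp (-h*t) * exp (-x*t)"
        unfolding exp_add[symmetric] by (simp add: algebra_simps)
      then have s: "tricomi_kernel a b (x+h) t = exp (-h*t) * tricomi_kernel a b x t"
        by (simp add: tricomi_kernel_def)
      have "t powr a = t * t powr (a-1)" using t by (simp add: powr_diff)
      then have m: "tricomi_kernel (a+1) b x t = t * tricomi_kernel a b x t"
        by (simp add: tricomi_kernel_def)
      have e: "?r t = (exp (-h*t) - 1 + h*t) * tricomi_kernel a b x t"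
        unfolding s m by (simp only: distrib_right left_diff_distrib mult_1 mult.assoc)
      have "exp (- (x/2) * t) = exp (x/2*t) * exp (-x*t)"
        unfolding exp_add[symmetric] by simp
      moreover have "t powr (a+2-1) = t^2 * t powr (a-1)"
        using t powr_add[of t 2 "a-1"] by (simp add: add.commute)
      ultimately have g: "?g t = (h*t)\<^sup>2 * exp (x/2*t) * tricomi_kernel a b x t"
        unfolding tricomi_kernel_def by (simp add: power_mult_distrib)
      show ?thesis unfolding e g abs_mult
        using mult_right_mono[OF ex, of "tricomi_kernel a b x t"]
          tricomi_kernel_bounds(1)[OF assms(2) t, of a x] by simp
    qed
    have eq: "tricomi_integral a b (x+h) - tricomi_integral a b x + h * tricomi_integral (a+1) b x = (LINT t:{0<..}|lborel. ?r t)"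
      unfolding tricomi_integral_def using i by (simp add: set_integral_add)
    have "\<bar>LINT t:{0<..}|lborel. ?r t\<bar> \<le> (LINT t:{0<..}|lborel. \<bar>?r t\<bar>)"
      using set_integral_norm_bound[OF ri] by simp
    also have "\<dots> \<le> (LINT t:{0<..}|lborel. ?g t)"
    proof (rule set_integral_mono)
      show "set_integrable lborel {0<..} (\<lambda>t. \<bar>?r t\<bar>)" by (rule set_integrable_abs[OF ri])
      show "set_integrable lborel {0<..} ?g" by (rule i)
      show "\<And>t. t \<in> {0<..} \<Longrightarrow> \<bar>?r t\<bar> \<le> ?g t" by (rule p) simp
    qed
    also have "\<dots> = h\<^sup>2 * tricomi_integral (a+2) b (x/2)" unfolding tricomi_integral_def by simp
    finally show ?thesis unfolding eq .
  qed
  let ?K = "tricomi_integral (a+2) b (x/2)"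
  have "((\<lambda>h. (tricomi_integral a b (x+h) - tricomi_integral a b x) / h - (- tricomi_integral (a+1) b x)) \<longlongrightarrow> 0) (at 0)"
  proof (rule Lim_null_comparison)
    show "((\<lambda>h. \<bar>h\<bar> * ?K) \<longlongrightarrow> 0) (at 0)" by (auto intro!: tendsto_eq_intros)
    have "eventually (\<lambda>h. \<bar>h\<bar> < x/2 \<and> h \<noteq> 0) (at (0::real))"
      unfolding eventually_at using assms by (intro exI[of _ "x/2"]) (auto simp: dist_real_def)
    then show "eventually (\<lambda>h. norm ((tricomi_integral a b (x+h) - tricomi_integral a b x) / h - (- tricomi_integral (a+1) b x)) \<le> \<bar>h\<bar> * ?K) (at 0)"
    proof eventually_elim
      case (elim h)
      have "(tricomi_integral a b (x+h) - tricomi_integral a b x) / h - (- tricomi_integral (a+1) b x) = (tricomi_integral a b (x+h) - tricomi_integral a b x + h * tricomi_integral (a+1) b x) / h"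
        using elim by (simp add: field_simps)
      then have "norm ((tricomi_integral a b (x+h) - tricomi_integral a b x) / h - (- tricomi_integral (a+1) b x)) \<le> h\<^sup>2 * ?K / \<bar>h\<bar>"
        using bound[of h] elim by (simp add: divide_right_mono)
      also have "\<dots> = \<bar>h\<bar> * ?K" using elim by (simp add: field_simps power2_eq_square abs_mult_self_eq)
      finally show ?case .
    qed
  qed
  then show ?thesis unfolding DERIV_def by (rule LIM_zero_cancel)
qed

text \<open>Integrating the two kernel bounds against Euler's integral confines the scaled function
  between Gamma(a) - b Gamma(a+1) / x and Gamma(a).\<close>

lemma tricomi_integral_asymptotic:
  assumes "a > 0" "b \<ge> 0"
  shows "((\<lambda>x. x powr a * tricomi_integral a b x) \<longlongrightarrow> Gamma a) at_top"
proof (rule tendsto_sandwich)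
  show "((\<lambda>x. Gamma a - b * Gamma (a+1) / x) \<longlongrightarrow> Gamma a) at_top" by real_asymp
  show "((\<lambda>x. Gamma a) \<longlongrightarrow> Gamma a) at_top" by simp
  have bounds: "x powr a * tricomi_integral a b x \<le> Gamma a" "Gamma a - b * Gamma (a+1) / x \<le> x powr a * tricomi_integral a b x"
    if x: "x > 0" for x
  proof -
    have "tricomi_integral a b x \<le> Gamma a * x powr (-a)"
      unfolding tricomi_integral_def Gamma_set_integral(2)[OF assms(1) x, symmetric]
      using assms x by (intro set_integral_mono tricomi_kernel_integrable Gamma_set_integral
        tricomi_kernel_bounds) auto
    then show "x powr a * tricomi_integral a b x \<le> Gamma a" using x by (simp add: powr_minus field_simps)
    let ?g = "\<lambda>t. exp (-x*t) * t powr (a-1) - b * (exp (-x*t) * t powr (a+1-1))"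
    have i: "set_integrable lborel {0<..} (\<lambda>t. exp (-x*t) * t powr (a-1))"
      "set_integrable lborel {0<..} (\<lambda>t. b * (exp (-x*t) * t powr (a+1-1)))"
      using assms x Gamma_set_integral(1)[of a x] Gamma_set_integral(1)[of "a+1" x] by auto
    have "Gamma a * x powr (-a) - b * (Gamma (a+1) * x powr (-(a+1))) = (LINT t:{0<..}|lborel. ?g t)"
      using i assms x Gamma_set_integral(2)[of a x] Gamma_set_integral(2)[of "a+1" x] 
      by (simp add: set_integral_diff)
    also have "\<dots> \<le> tricomi_integral a b x" unfolding tricomi_integral_def
    proof (rule set_integral_mono)
      show "set_integrable lborel {0<..} ?g" using i by (rule set_integral_diff)
      show "set_integrable lborel {0<..} (tricomi_kernel a b x)"
        using assms x by (intro tricomi_kernel_integrable)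
      fix t :: real assume "t \<in> {0<..}"
      then have t: "t > 0" by simp
      have "?g t = (1 - b * t) * (exp (-x*t) * t powr (a-1))"
        using t by (simp add: powr_diff field_simps)
      then show "?g t \<le> tricomi_kernel a b x t" using tricomi_kernel_bounds(3)[OF assms(2) t] by simp
    qed
    finally have "x powr a * (Gamma a * x powr (-a) - b * (Gamma (a+1) * x powr (-(a+1)))) \<le> x powr a * tricomi_integral a b x"
      by (simp add: mult_left_mono)
    moreover have "x powr (-(a+1)) = x powr (-a) / x" using x powr_diff[of x "-a" 1] by simp
    moreover have "x powr a * x powr (-a) = 1" using x by (simp add: powr_minus)
    then have "x powr a * (Gamma a * x powr (-a) - b * (Gamma (a+1) * (x powr (-a) / x)))
        = Gamma a - b * Gamma (a+1) / x"
      by (simp add: right_diff_distrib mult.left_commute[of "x powr a"])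
    ultimately show "Gamma a - b * Gamma (a+1) / x \<le> x powr a * tricomi_integral a b x" by simp
  qed
  show "eventually (\<lambda>x. x powr a * tricomi_integral a b x \<le> Gamma a) at_top"
    using eventually_gt_at_top[of 0] by eventually_elim (rule bounds)
  show "eventually (\<lambda>x. Gamma a - b * Gamma (a+1) / x \<le> x powr a * tricomi_integral a b x) at_top"
    using eventually_gt_at_top[of 0] by eventually_elim (rule bounds)
qed

section \<open>Uniqueness of the solution normalised at infinity\<close>

text \<open>The quotient argument works only beyond some \<open>X\<close>, where the limit keeps
  \<open>z\<close> positive. Zeros of \<open>z\<close> are not excluded below \<open>X\<close>, so
  equality is carried down to an arbitrary \<open>x > 0\<close> by estimating the difference of the
  two solutions together with its derivative.\<close>

lemma kummer_solution_unique:
  assumes "kummer_solution a c y" "kummer_solution a c z"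
    and limy: "((\<lambda>x. x powr a * y x) \<longlongrightarrow> 1) at_top"
    and limz: "((\<lambda>x. x powr a * z x) \<longlongrightarrow> 1) at_top"
    and x: "x > 0"
  shows "y x = z x"
proof -
  obtain y' y'' where
    y: "\<And>x. x > 0 \<Longrightarrow> (y has_real_derivative y' x) (at x)"
       "\<And>x. x > 0 \<Longrightarrow> (y' has_real_derivative y'' x) (at x)"
       "\<And>x. x > 0 \<Longrightarrow> x * y'' x + (c - x) * y' x - a * y x = 0"
    using assms(1) unfolding kummer_solution_def by blast
  obtain z' z'' where
    z: "\<And>x. x > 0 \<Longrightarrow> (z has_real_derivative z' x) (at x)"
       "\<And>x. x > 0 \<Longrightarrow> (z' has_real_derivative z'' x) (at x)"
       "\<And>x. x > 0 \<Longrightarrow> x * z'' x + (c - x) * z' x - a * z x = 0"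
    using assms(2) unfolding kummer_solution_def by blast
  \<comment> \<open>The Wronskian and Abel's identity: x^c exp(-x) is the integrating factor of the
    equation, so \<open>k\<close> is constant.\<close>
  define W where "W = (\<lambda>x. y' x * z x - y x * z' x)"
  define k where "k = (\<lambda>x. x powr c * exp (-x) * W x)"
  have k0: "(k has_real_derivative 0) (at x)" if x: "x > 0" for x
  proof -
    have y2: "y'' x = (a * y x - (c - x) * y' x) / x" and z2: "z'' x = (a * z x - (c - x) * z' x) / x"
      using y(3)[OF x] z(3)[OF x] x by (simp_all add: field_simps)
    have "(k has_real_derivative
        (c * x powr (c-1) * exp (-x) - x powr c * exp (-x)) * W x
          + x powr c * exp (-x) * (y'' x * z x - y x * z'' x)) (at x)"
      unfolding k_def W_def
      by (auto intro!: derivative_eq_intros y z x simp: algebra_simps)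
    moreover have "(c * x powr (c-1) * exp (-x) - x powr c * exp (-x)) * W x
          + x powr c * exp (-x) * (y'' x * z x - y x * z'' x) = 0"
      unfolding y2 z2 W_def using x by (simp add: powr_diff field_simps)
    ultimately show ?thesis by simp
  qed
  obtain K where K: "\<And>x. x > 0 \<Longrightarrow> k x = K"
  proof -
    have "k x = k 1" if "x > 0" for x
      by (rule DERIV_isconst3[of "min x 1 / 2" "max x 1 + 1"]) (use that in \<open>auto intro!: k0\<close>)
    then show ?thesis using that by blast
  qed
  have W: "W x = K * (x powr (-c) * exp x)" if "x > 0" for x
    using K[OF that] that by (simp add: k_def powr_minus exp_minus field_simps)
  have "eventually (\<lambda>x. 0 < x powr a * z x \<and> x powr a * z x < 2 \<and> x > 0) at_top"
    using order_tendstoD[OF limz, of 0] order_tendstoD[OF limz, of 2] eventually_gt_at_top[of 0]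
    by (auto simp: eventually_conj_iff)
  then obtain X where X: "\<And>x. x \<ge> X \<Longrightarrow> 0 < x powr a * z x \<and> x powr a * z x < 2 \<and> x > 0"
    unfolding eventually_at_top_linorder by blast
  have zpos: "z x > 0" "x > 0" if "x \<ge> X" for x
    using X[OF that] by (auto simp: zero_less_mult_iff)
  have zle: "z x < 2 * x powr (-a)" if "x \<ge> X" for x
    using X[OF that] by (simp add: powr_minus field_simps)
  define r where "r = (\<lambda>x. y x / z x)"
  have r': "(r has_real_derivative W x / (z x)\<^sup>2) (at x)" if "x \<ge> X" for x
    unfolding r_def W_def using zpos[OF that]
    by (auto intro!: derivative_eq_intros y z simp: power2_eq_square)
  have rlim: "(r \<longlongrightarrow> 1) at_top"
  proof -
    have "((\<lambda>x. (x powr a * y x) / (x powr a * z x)) \<longlongrightarrow> 1 / 1) at_top"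
      by (intro tendsto_divide limy limz) simp
    moreover have "eventually (\<lambda>x. (x powr a * y x) / (x powr a * z x) = r x) at_top"
      using eventually_gt_at_top[of 0] by eventually_elim (simp add: r_def)
    ultimately show ?thesis by (simp cong: filterlim_cong add: tendsto_cong)
  qed
  have "K = 0"
  proof (rule ccontr)
    assume "K \<noteq> 0"
    \<comment> \<open>The expression is a lower bound for \<bar>W\<bar> / z^2, because z^2 is below
      4 x^(-2a).\<close>
    then have "filterlim (\<lambda>x. \<bar>K\<bar> / 4 * (x powr (2*a-c) * exp x)) at_top at_top"
      by real_asymp
    then obtain X1 where X1: "\<And>x. x \<ge> X1 \<Longrightarrow> \<bar>K\<bar> / 4 * (x powr (2*a-c) * exp x) \<ge> 1"
      unfolding filterlim_at_top eventually_at_top_linorder by blast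
    have big: "1 \<le> \<bar>W x / (z x)\<^sup>2\<bar>" if x: "x \<ge> max X X1" for x
    proof -
      have "(z x)\<^sup>2 \<le> (2 * x powr (-a))\<^sup>2"
        using zle[of x] zpos[of x] x by (intro power_mono) auto
      also have "\<dots> = 4 * x powr (-2*a)"
        using zpos[of x] x by (simp add: power_mult_distrib power2_eq_square powr_add[symmetric])
      also have "\<dots> \<le> 4 * x powr (-2*a) * (\<bar>K\<bar> / 4 * (x powr (2*a-c) * exp x))"
        using mult_left_mono[OF X1[of x], of "4 * x powr (-2*a)"] x by simp
      also have "\<dots> = \<bar>K\<bar> * (x powr (-c) * exp x)"
        using zpos[of x] x by (simp add: powr_add[symmetric] mult_ac)
      also have "\<dots> = \<bar>W x\<bar>" using W[of x] zpos[of x] x by (simp add: abs_mult)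
      finally show ?thesis using zpos[of x] x by (simp add: field_simps)
    qed
    \<comment> \<open>Convergence of \<open>r\<close> makes its increments over unit intervals tend
      to 0, while the mean value theorem makes them at least 1 in absolute value.\<close>
    have "filterlim (\<lambda>x::real. x + 1) at_top at_top" by real_asymp
    then have "((\<lambda>x. r (x + 1) - r x) \<longlongrightarrow> 1 - 1) at_top"
      by (intro tendsto_diff rlim filterlim_compose[OF rlim])
    then have "eventually (\<lambda>x. dist (r (x + 1) - r x) 0 < 1) at_top"
      by (intro tendstoD) auto
    then obtain u where u: "u \<ge> max X X1" "\<bar>r (u + 1) - r u\<bar> < 1"
      using eventually_happens[OF eventually_conj[OF eventually_ge_at_top[of "max X X1"]]]
      by (auto simp: dist_real_def)
    have "\<exists>v>u. v < u + 1 \<and> r (u + 1) - r u = (u + 1 - u) * (W v / (z v)\<^sup>2)"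
      by (rule MVT2) (use r' u in auto)
    then obtain v where v: "v > u" "r (u + 1) - r u = W v / (z v)\<^sup>2" by auto
    have "1 \<le> \<bar>W v / (z v)\<^sup>2\<bar>" using v(1) u(1) by (intro big) linarith
    then show False using u(2) v(2) by simp
  qed
  define d where "d = (\<lambda>x. y x - z x)"
  define d' where "d' = (\<lambda>x. y' x - z' x)"
  have dX: "d X' = 0 \<and> d' X' = 0" if "X' > X" for X'
  proof -
    have "r t = 1" if "t \<ge> X" for t
    proof -
      have "(r \<longlongrightarrow> r t) at_top"
      proof (rule tendsto_eventually)
        have r0: "(r has_real_derivative 0) (at s)" if "s \<ge> X" for s
          using r'[OF that] W[of s] zpos[OF that] \<open>K = 0\<close> by simp
        have "r s = r t" if "s \<ge> t" for s
        proof (cases "s = t")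
          case False
          show ?thesis
            by (rule DERIV_isconst_end[of t s r])
              (use r0 False that \<open>t \<ge> X\<close> in \<open>auto intro!: DERIV_atLeastAtMost_imp_continuous_on exI[of _ 0]\<close>)
        qed simp
        then show "eventually (\<lambda>s. r s = r t) at_top"
          unfolding eventually_at_top_linorder by blast
      qed
      then show ?thesis using rlim tendsto_unique trivial_limit_at_top_linorder by blast
    qed
    then have yz: "y t = z t" if "t \<ge> X" for t
      using that zpos[of t] by (auto simp: r_def)
    \<comment> \<open>With y = z nonzero at this point, a vanishing Wronskian forces the first
      derivatives to agree as well.\<close>
    moreover have "W X' = 0" using W[of X'] zpos[of X'] that \<open>K = 0\<close> by simp
    ultimately show ?thesis using zpos[of X'] that yz[of X']
      by (auto simp: W_def d_def d'_def)
  qed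
  define B where "B = max X x + 1"
  \<comment> \<open>\<open>M\<close> collects the bounds on [x,B]: the 1 pays for 2 d d', the other
    two terms for 2 d' d'' after d'' is eliminated by the equation, using \<bar>t - c\<bar> \<le> B
    + \<bar>c\<bar> and 1/t \<le> 1/x.\<close>
  define M where "M = 1 + 2 * (B + \<bar>c\<bar>) / x + \<bar>a\<bar> / x"
  have B: "B > X" "B > x" by (auto simp: B_def)
  define E where "E = (\<lambda>t. ((d t)\<^sup>2 + (d' t)\<^sup>2) * exp (M * t))"
  \<comment> \<open>Gronwall, run backwards from a point where \<open>d\<close> and \<open>d'\<close> vanish.\<close>
  have "E x \<le> E B"
  proof (rule DERIV_nonneg_imp_nondecreasing[of x B E])
    show "x \<le> B" using B by simp
    fix t assume t: "x \<le> t" "t \<le> B"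
    then have t0: "t > 0" using x by simp
    define q where "q = ((t - c) * d' t + a * d t) / t"
    have "y'' t - z'' t = q"
      using y(3)[OF t0] z(3)[OF t0] t0 by (simp add: q_def d_def d'_def field_simps)
    then have D: "(E has_real_derivative
       (2 * d t * d' t + 2 * d' t * q + M * ((d t)\<^sup>2 + (d' t)\<^sup>2)) * exp (M * t)) (at t)"
      unfolding E_def d_def d'_def
      by (auto intro!: derivative_eq_intros y z t0 simp: algebra_simps)
    have am: "2 * \<bar>d t\<bar> * \<bar>d' t\<bar> \<le> (d t)\<^sup>2 + (d' t)\<^sup>2"
      using sum_squares_bound[of "\<bar>d t\<bar>" "\<bar>d' t\<bar>"] by simp
    have "\<bar>q\<bar> \<le> (B + \<bar>c\<bar>) / x * \<bar>d' t\<bar> + \<bar>a\<bar> / x * \<bar>d t\<bar>"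
    proof -
      have "\<bar>q\<bar> \<le> (\<bar>t - c\<bar> * \<bar>d' t\<bar> + \<bar>a\<bar> * \<bar>d t\<bar>) / t"
        unfolding q_def using t0 by (simp add: divide_right_mono abs_mult[symmetric] abs_triangle_ineq)
      also have "\<dots> \<le> ((B + \<bar>c\<bar>) * \<bar>d' t\<bar> + \<bar>a\<bar> * \<bar>d t\<bar>) / x"
        using t t0 x by (intro frac_le add_mono mult_right_mono) auto
      finally show ?thesis by (simp add: add_divide_distrib distrib_right)
    qed
    then have "\<bar>2 * d' t * q\<bar> \<le> 2 * \<bar>d' t\<bar> * ((B + \<bar>c\<bar>) / x * \<bar>d' t\<bar> + \<bar>a\<bar> / x * \<bar>d t\<bar>)"
      by (simp add: abs_mult mult_left_mono)
    also have "\<dots> = 2 * (B + \<bar>c\<bar>) / x * (d' t)\<^sup>2 + \<bar>a\<bar> / x * (2 * \<bar>d t\<bar> * \<bar>d' t\<bar>)"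
    proof -
      have "2 * P * (R * P + S * Q) = 2 * R * P\<^sup>2 + S * (2 * Q * P)" for P Q R S :: real
        by (simp add: algebra_simps power2_eq_square)
      from this[of "\<bar>d' t\<bar>" "(B + \<bar>c\<bar>) / x" "\<bar>a\<bar> / x" "\<bar>d t\<bar>"] show ?thesis by simp
    qed
    also have "\<dots> \<le> 2 * (B + \<bar>c\<bar>) / x * ((d t)\<^sup>2 + (d' t)\<^sup>2) + \<bar>a\<bar> / x * ((d t)\<^sup>2 + (d' t)\<^sup>2)"
      using am x B by (intro add_mono mult_left_mono) auto
    finally have "\<bar>2 * d' t * q\<bar> \<le> (M - 1) * ((d t)\<^sup>2 + (d' t)\<^sup>2)"
      by (simp add: M_def distrib_right)
    moreover have "\<bar>2 * d t * d' t\<bar> \<le> (d t)\<^sup>2 + (d' t)\<^sup>2" using am by (simp add: abs_mult)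
    ultimately have "0 \<le> 2 * d t * d' t + 2 * d' t * q + M * ((d t)\<^sup>2 + (d' t)\<^sup>2)"
      unfolding left_diff_distrib mult_1 by linarith
    then show "\<exists>l. (E has_real_derivative l) (at t) \<and> 0 \<le> l"
      using D by (meson exp_ge_zero mult_nonneg_nonneg)
  qed
  moreover have "E B = 0" using dX[OF B(1)] by (simp add: E_def)
  ultimately have "(d x)\<^sup>2 + (d' x)\<^sup>2 \<le> 0" by (simp add: E_def mult_le_0_iff)
  then show ?thesis by (simp add: d_def sum_power2_le_zero_iff)
qed

text \<open>The candidate is cut off to 0 on x \<le> 0 to match the convention in
  \<open>tricomi\<close>; derivatives at x > 0 are unaffected because the half-line is open.\<close>

lemma tricomi_unique:
  assumes "kummer_solution a c y" "((\<lambda>x. x powr a * y x) \<longlongrightarrow> 1) at_top" "x > 0"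
  shows "tricomi a c x = y x"
proof -
  define u where "u = (\<lambda>x. if x > 0 then y x else 0)"
  have u: "kummer_solution a c u" "((\<lambda>x. x powr a * u x) \<longlongrightarrow> 1) at_top"
  proof -
    obtain y' y'' where y: "\<And>x. x > 0 \<Longrightarrow> (y has_real_derivative y' x) (at x) \<and>
        (y' has_real_derivative y'' x) (at x) \<and> x * y'' x + (c - x) * y' x - a * y x = 0"
      using assms(1) unfolding kummer_solution_def by blast
    have "(u has_real_derivative y' x) (at x)" if "x > 0" for x
      by (rule has_field_derivative_transform_within_open[of y _ _ "{0<..}"])
         (use y that in \<open>auto simp: u_def\<close>)
    then show "kummer_solution a c u" unfolding kummer_solution_def
      using y by (intro exI[of _ y'] exI[of _ y'']) (auto simp: u_def)
    show "((\<lambda>x. x powr a * u x) \<longlongrightarrow> 1) at_top"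
    using assms(2) by (rule Lim_transform_eventually)
      (use eventually_gt_at_top[of 0] in \<open>eventually_elim, simp add: u_def\<close>)
  qed
  have "tricomi a c = u"
    unfolding tricomi_def
  proof (intro the_equality ext conjI allI impI)
    fix z t assume z: "kummer_solution a c z \<and> ((\<lambda>x. x powr a * z x) \<longlongrightarrow> 1) at_top \<and> (\<forall>x\<le>0. z x = 0)"
    show "z t = u t"
    proof (cases "t > 0")
      case True
      then show ?thesis using z u by (intro kummer_solution_unique[of a c]) auto
    next
      case False
      then show ?thesis using z by (simp add: u_def)
    qed
  qed (use u in \<open>auto simp: u_def\<close>)
  then show ?thesis using assms(3) by (simp add: u_def)
qed

section \<open>Positivity from a differential equation and a limit at infinity\<close>

text \<open>Once \<open>d \<le> 0\<close>, the function \<open>d\<close> decreases forever, so its limit would be negative.\<close>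
lemma barrier_pos:
  fixes d d' \<delta> m :: "real \<Rightarrow> real"
  assumes d: "\<And>x. x > 0 \<Longrightarrow> (d has_real_derivative d' x) (at x)"
    and ode: "\<And>x. x > 0 \<Longrightarrow> x * d' x = \<delta> x + m x * d x"
    and \<delta>: "\<And>x. x > 0 \<Longrightarrow> \<delta> x < 0" and m: "\<And>x. x > 0 \<Longrightarrow> m x \<ge> 0"
    and lim: "(d \<longlongrightarrow> l) at_top" "l \<ge> 0" and x: "x > 0"
  shows "d x > 0"
proof (rule ccontr)
  assume "\<not> d x > 0"
  have neg: "d' t < 0" if "t > 0" "d t \<le> 0" for t
  proof -
    have "m t * d t \<le> 0" using m[of t] that by (simp add: mult_nonneg_nonpos)
    then have "t * d' t < 0" using ode[of t] \<delta>[of t] that by linarith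
    then show ?thesis using that by (simp add: mult_less_0_iff)
  qed
  have stay: "d t \<le> 0" if t: "t \<ge> x" for t
  proof (rule ccontr)
    assume dt: "\<not> d t \<le> 0"
    have "continuous_on {x..t} d"
      by (rule DERIV_atLeastAtMost_imp_continuous_on) (meson d x less_le_trans)
    \<comment> \<open>Compactness supplies the last point \<open>s\<close> of [x,t] with
      \<open>d s \<le> 0\<close>. There \<open>d\<close> is strictly decreasing, so points just to
      the right of \<open>s\<close> also qualify, a contradiction.\<close>
    then have "compact {s \<in> {x..t}. d s \<le> 0}"
      using continuous_closed_preimage[of "{x..t}" d "{..0}"]
      by (auto intro!: compact_Int_closed simp: compact_eq_bounded_closed vimage_def Int_def
          intro: bounded_subset[OF bounded_closed_interval])
    moreover have "{s \<in> {x..t}. d s \<le> 0} \<noteq> {}" using \<open>\<not> d x > 0\<close> t by force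
    ultimately obtain s where s: "s \<in> {x..t}" "d s \<le> 0" "\<And>r. r \<in> {x..t} \<Longrightarrow> d r \<le> 0 \<Longrightarrow> r \<le> s"
      using compact_attains_sup[of "{s \<in> {x..t}. d s \<le> 0}"] by blast
    have st: "s < t" using s dt by (cases "s = t") auto
    have s0: "s > 0" using s x by simp
    obtain e where e: "e > 0" "\<And>h. 0 < h \<Longrightarrow> h < e \<Longrightarrow> d (s + h) < d s"
      using DERIV_neg_dec_right[OF d[OF s0] neg[OF s0 s(2)]] by blast
    define h where "h = min (e / 2) (t - s)"
    have h: "0 < h" "h < e" "s + h \<le> t" using e st by (auto simp: h_def min_def)
    then have "d (s + h) \<le> 0" using e(2)[of h] s(2) by linarith
    then have "s + h \<le> s" using s(1) h by (intro s(3)) auto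
    then show False using h by simp
  qed
  have "l < d x"
  proof (rule DERIV_neg_imp_decreasing_at_top[OF _ lim(1)])
    fix t assume "t \<ge> x"
    then show "\<exists>y. (d has_real_derivative y) (at t) \<and> y < 0"
      using d[of t] neg[of t] stay[of t] x by auto
  qed
  then show False using lim(2) \<open>\<not> d x > 0\<close> by simp
qed

lemma tendsto_zero_of_mult_at_top:
  assumes "((\<lambda>x. x * f x) \<longlongrightarrow> (l::real)) at_top"
  shows "(f \<longlongrightarrow> 0) at_top"
proof -
  have "((\<lambda>x. x * f x * (1 / x)) \<longlongrightarrow> l * 0) at_top"
    by (intro tendsto_mult assms) real_asymp
  then have "((\<lambda>x. x * f x * (1 / x)) \<longlongrightarrow> 0) at_top" by simp
  then show ?thesis
    by (rule Lim_transform_eventually)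
       (use eventually_gt_at_top[of 0] in \<open>eventually_elim, simp\<close>)
qed

section \<open>Logarithmic derivative, contiguous relations and the Turanian quotient\<close>

text \<open>The bound on \<open>c\<close> says that \<open>b\<close> is positive. It passes from
  \<open>a\<close> to \<open>a + 1\<close>, so the locale can be interpreted a second time for the
  upper neighbour.\<close>

locale tricomi_parameters =
  fixes a c :: real
  assumes a_pos: "a > 0" and c_less: "c < 1 + a"
begin

definition "b = 1 + a - c"

lemma b_pos: "b > 0" using c_less by (simp add: b_def)

text \<open>\<open>p\<close> is minus the logarithmic derivative of \<open>\<psi>(a,c,\<cdot>)\<close>, and \<open>v = - x p'\<close>.\<close>
definition "p x = tricomi_integral (a+1) b x / tricomi_integral a b x"

definition "v x = a - (x - c) * p x - x * (p x)\<^sup>2"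

lemma Gamma_nz [simp]: "Gamma a \<noteq> 0"
  using Gamma_real_pos[OF a_pos] by simp

lemma tricomi_integral_nz: "x > 0 \<Longrightarrow> tricomi_integral a b x > 0" "x > 0 \<Longrightarrow> tricomi_integral (a+1) b x > 0" "x > 0 \<Longrightarrow> tricomi_integral (a+1) (b+1) x > 0"
  using tricomi_integral_pos a_pos b_pos by auto

lemma p_pos: "x > 0 \<Longrightarrow> p x > 0"
  unfolding p_def using tricomi_integral_nz by simp

lemma a_minus_xp: "x > 0 \<Longrightarrow> a - x * p x = b * tricomi_integral (a+1) (b+1) x / tricomi_integral a b x"
  unfolding p_def using tricomi_integral_nz[of x] tricomi_integral_by_parts[of a b x] a_pos b_pos by (simp add: field_simps)

lemma xp_less: "x > 0 \<Longrightarrow> x * p x < a"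
  using a_minus_xp[of x] tricomi_integral_nz[of x] b_pos by (smt (verit) divide_pos_pos mult_pos_pos)

text \<open>Integration by parts at \<open>b+1\<close> discards a positive term, and the integral
  decreases in \<open>b\<close>. Divided by \<open>a * b * x\<close>, the estimate says that
  psi(a+1)/psi(a) is below 1/x.\<close>

lemma x_a_minus_xp_less:
  assumes "x > 0"
  shows "x * (a - x * p x) < a * b"
proof -
  have "x * tricomi_integral (a+1) (b+1) x < a * tricomi_integral a (b+1) x"
    using tricomi_integral_by_parts[of a "b+1" x] tricomi_integral_pos[of "a+1" "b+1+1" x] a_pos b_pos assms by simp
  also have "\<dots> < a * tricomi_integral a b x" using tricomi_integral_strict_decreasing[of a b x] a_pos b_pos assms by simp
  finally have "b * (x * tricomi_integral (a+1) (b+1) x) < b * (a * tricomi_integral a b x)" using b_pos by simp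
  then show ?thesis
    unfolding a_minus_xp[OF assms] using tricomi_integral_nz[OF assms] by (simp add: field_simps)
qed

lemma x_a_minus_xp_lim: "((\<lambda>x. x * (a - x * p x)) \<longlongrightarrow> a * b) at_top"
proof -
  have "((\<lambda>x. b * (x powr (a+1) * tricomi_integral (a+1) (b+1) x) / (x powr a * tricomi_integral a b x))
      \<longlongrightarrow> b * Gamma (a+1) / Gamma a) at_top"
    using a_pos b_pos Gamma_real_pos[of a] by (intro tendsto_intros tricomi_integral_asymptotic) auto
  also have "b * Gamma (a+1) / Gamma a = a * b"
    using Gamma_real_pos[OF a_pos] Gamma_plus1[of a] a_pos by (simp add: nonpos_Ints_def)
  finally show ?thesis
    by (rule Lim_transform_eventually)
       (use eventually_gt_at_top[of 0] in \<open>eventually_elim, simp add: a_minus_xp powr_add\<close>)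
qed

lemma xp_lim: "((\<lambda>x. x * p x) \<longlongrightarrow> a) at_top"
proof -
  have "((\<lambda>x. a - x * (a - x * p x) * (1 / x)) \<longlongrightarrow> a - a * b * 0) at_top"
    by (intro tendsto_diff tendsto_const tendsto_mult x_a_minus_xp_lim) real_asymp
  then have "((\<lambda>x. a - x * (a - x * p x) * (1 / x)) \<longlongrightarrow> a) at_top" by simp
  then show ?thesis
    by (rule Lim_transform_eventually)
       (use eventually_gt_at_top[of 0] in \<open>eventually_elim, simp\<close>)
qed

lemma p_lim: "(p \<longlongrightarrow> 0) at_top" by (rule tendsto_zero_of_mult_at_top[OF xp_lim])

text \<open>Knowing that x p tends to a yields nothing about x (a - x p); the second-order limit
  \<open>x_a_minus_xp_lim\<close> is what determines the value a b + c a - a^2 = a.\<close>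

lemma xv_lim: "((\<lambda>x. x * v x) \<longlongrightarrow> a) at_top"
proof -
  have "((\<lambda>x. x * (a - x * p x) + c * (x * p x) - (x * p x)\<^sup>2) \<longlongrightarrow> a * b + c * a - a\<^sup>2) at_top"
    by (intro tendsto_intros x_a_minus_xp_lim xp_lim)
  moreover have "a * b + c * a - a\<^sup>2 = a" by (simp add: b_def algebra_simps power2_eq_square)
  moreover have "x * (a - x * p x) + c * (x * p x) - (x * p x)\<^sup>2 = x * v x" for x
    by (simp add: v_def algebra_simps power2_eq_square)
  ultimately show ?thesis by simp
qed

lemma v_lim: "(v \<longlongrightarrow> 0) at_top" by (rule tendsto_zero_of_mult_at_top[OF xv_lim])

text \<open>Each derivative in \<open>x\<close> is minus a shift of \<open>a\<close>, so this is
  Kummer's equation for the integral. Two integrations by parts bring in integrals at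
  \<open>b+1\<close>, whose sum is removed by \<open>tricomi_integral_split\<close>.\<close>

lemma tricomi_integral_kummer:
  assumes "x > 0"
  shows "x * tricomi_integral (a+2) b x - (c - x) * tricomi_integral (a+1) b x - a * tricomi_integral a b x = 0"
proof -
  have "x * tricomi_integral (a+2) b x = (a+1) * tricomi_integral (a+1) b x - b * tricomi_integral (a+2) (b+1) x"
    "x * tricomi_integral (a+1) b x = a * tricomi_integral a b x - b * tricomi_integral (a+1) (b+1) x"
    "tricomi_integral (a+1) b x = tricomi_integral (a+1) (b+1) x + tricomi_integral (a+2) (b+1) x"
    using tricomi_integral_by_parts[of "a+1" b x] tricomi_integral_by_parts[of a b x] tricomi_integral_split[of "a+1" b x] a_pos b_pos assms
    by (simp_all add: add.assoc)
  moreover have "c = 1 + a - b" by (simp add: b_def)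
  ultimately show ?thesis by algebra
qed

lemma p_deriv:
  assumes "x > 0"
  shows "(p has_real_derivative - v x / x) (at x)"
proof -
  have "(p has_real_derivative
     (- tricomi_integral (a+2) b x * tricomi_integral a b x - tricomi_integral (a+1) b x * (- tricomi_integral (a+1) b x)) / (tricomi_integral a b x * tricomi_integral a b x)) (at x)"
    unfolding p_def using tricomi_integral_nz(1)[OF assms] tricomi_integral_has_derivative[of "a+1" b x] a_pos b_pos assms
    by (intro DERIV_divide tricomi_integral_has_derivative) (auto simp: add.assoc)
  moreover have J2: "tricomi_integral (a+2) b x = ((c - x) * tricomi_integral (a+1) b x + a * tricomi_integral a b x) / x"
    using tricomi_integral_kummer[OF assms] assms by (simp add: field_simps)
  have "(- tricomi_integral (a+2) b x * tricomi_integral a b x - tricomi_integral (a+1) b x * (- tricomi_integral (a+1) b x)) / (tricomi_integral a b x * tricomi_integral a b x) = - v x / x"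
    unfolding v_def p_def J2 using tricomi_integral_nz(1)[OF assms] assms by (simp add: field_simps power2_eq_square)
  ultimately show ?thesis by simp
qed

lemma v_deriv:
  assumes "x > 0"
  shows "(v has_real_derivative ((x - c + 2 * x * p x) * v x - x * (p x + (p x)\<^sup>2)) / x) (at x)"
proof -
  have "(v has_real_derivative
     - (p x + (x - c) * (- v x / x)) - ((p x)\<^sup>2 + x * (2 * p x * (- v x / x)))) (at x)"
  proof -
    define q where "q = - v x / x"
    have "v = (\<lambda>x. a - (x - c) * p x - x * (p x)\<^sup>2)" by (simp add: fun_eq_iff v_def)
    then show ?thesis
      using p_deriv[OF assms] unfolding q_def[symmetric]
      by (auto intro!: derivative_eq_intros simp: algebra_simps)
  qed
  moreover have "- (p x + (x - c) * (- v x / x)) - ((p x)\<^sup>2 + x * (2 * p x * (- v x / x)))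
     = ((x - c + 2 * x * p x) * v x - x * (p x + (p x)\<^sup>2)) / x"
    using assms by (simp add: field_simps power2_eq_square)
  ultimately show ?thesis by simp
qed

text \<open>The classical integral representation of psi(a,c,x), since -b = c - a - 1;
  \<open>tricomi_eq\<close> makes the identification.\<close>

definition "U x = tricomi_integral a b x / Gamma a"

lemma U_pos: "x > 0 \<Longrightarrow> U x > 0"
  unfolding U_def using tricomi_integral_nz a_pos Gamma_real_pos by simp

lemma U_deriv: "x > 0 \<Longrightarrow> (U has_real_derivative - p x * U x) (at x)"
  unfolding U_def p_def using tricomi_integral_has_derivative[of a b x] a_pos b_pos tricomi_integral_nz[of x]
  by (auto intro!: derivative_eq_intros simp: Gamma_real_pos)

lemma U'_deriv:
  assumes "x > 0"
  shows "((\<lambda>x. - p x * U x) has_real_derivative (v x / x + (p x)\<^sup>2) * U x) (at x)"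
  using p_deriv[OF assms] U_deriv[OF assms]
  by (auto intro!: derivative_eq_intros simp: algebra_simps power2_eq_square)

lemma U_kummer: "kummer_solution a c U"
  unfolding kummer_solution_def
proof (intro exI allI impI conjI)
  fix x :: real assume x: "x > 0"
  show "(U has_real_derivative - p x * U x) (at x)" by (rule U_deriv[OF x])
  show "((\<lambda>x. - p x * U x) has_real_derivative (v x / x + (p x)\<^sup>2) * U x) (at x)"
    by (rule U'_deriv[OF x])
  show "x * ((v x / x + (p x)\<^sup>2) * U x) + (c - x) * (- p x * U x) - a * U x = 0"
    using x by (simp add: v_def field_simps)
qed

lemma U_lim: "((\<lambda>x. x powr a * U x) \<longlongrightarrow> 1) at_top"
proof -
  have "((\<lambda>x. x powr a * tricomi_integral a b x / Gamma a) \<longlongrightarrow> Gamma a / Gamma a) at_top"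
    using a_pos b_pos Gamma_real_pos[OF a_pos] by (intro tendsto_divide tricomi_integral_asymptotic tendsto_const) auto
  then show ?thesis using Gamma_real_pos[OF a_pos] by (simp add: U_def)
qed

lemma tricomi_eq: "x > 0 \<Longrightarrow> tricomi a c x = U x"
  by (rule tricomi_unique[OF U_kummer U_lim])

text \<open>The right side is the contiguous expression (x + a - c) psi - x psi'. It is checked
  directly to solve the equation for \<open>a - 1\<close> with the right normalisation, so the sign
  of a - 1 does not matter.\<close>

lemma tricomi_lower:
  assumes "x > 0"
  shows "tricomi (a - 1) c x = (x + a - c + x * p x) * U x"
proof (rule tricomi_unique[OF _ _ assms])
  let ?Y = "\<lambda>x. (x + a - c + x * p x) * U x"
  show "kummer_solution (a - 1) c ?Y"
    unfolding kummer_solution_def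
  proof (intro exI allI impI conjI)
    fix x :: real assume x: "x > 0"
    have xv: "x * (v x / x + (p x)\<^sup>2) = a + (c - x) * p x" using x by (simp add: v_def field_simps)
    have "(?Y has_real_derivative ((1 + (p x + x * (- v x / x))) * U x
             + (x + a - c + x * p x) * (- p x * U x))) (at x)"
      using p_deriv[OF x] U_deriv[OF x] by (auto intro!: derivative_eq_intros)
    moreover have "x * (- v x / x) = - v x" using x by simp
    \<comment> \<open>Kummer's equation collapses the derivative to (1 - a) (psi - psi'), so the
      second derivative of \<open>?Y\<close> involves nothing beyond psi''.\<close>
    moreover have "(1 + (p x + (- v x))) * U x + (x + a - c + x * p x) * (- p x * U x)
        = (1 - a) * (U x - (- p x * U x))"
      by (simp add: v_def algebra_simps power2_eq_square)
    ultimately show "(?Y has_real_derivative (1 - a) * (U x - (- p x * U x))) (at x)" by simp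
    show "((\<lambda>x. (1 - a) * (U x - (- p x * U x))) has_real_derivative
        (1 - a) * (- p x * U x - (v x / x + (p x)\<^sup>2) * U x)) (at x)"
      by (intro DERIV_cmult DERIV_diff U_deriv U'_deriv x)
    have "x * ((1 - a) * (- P * V - w * V)) = (1 - a) * (- (x * P) - x * w) * V" for P V w
      by (simp add: algebra_simps)
    then have "x * ((1 - a) * (- p x * U x - (v x / x + (p x)\<^sup>2) * U x))
        = (1 - a) * (- (x * p x) - x * (v x / x + (p x)\<^sup>2)) * U x" .
    also have "\<dots> = (1 - a) * (- (x * p x) - (a + (c - x) * p x)) * U x" unfolding xv ..
    finally show "x * ((1 - a) * (- p x * U x - (v x / x + (p x)\<^sup>2) * U x))
        + (c - x) * ((1 - a) * (U x - (- p x * U x))) - (a - 1) * ?Y x = 0"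
      by (simp add: algebra_simps)
  qed
  have "((\<lambda>x. x powr a * U x * ((x + a - c) / x) + x powr a * U x * p x) \<longlongrightarrow> 1 * 1 + 1 * 0) at_top"
    by (intro tendsto_add tendsto_mult U_lim p_lim) real_asymp
  then have "((\<lambda>x. x powr a * U x * ((x + a - c) / x) + x powr a * U x * p x) \<longlongrightarrow> 1) at_top" by simp
  then show "((\<lambda>x. x powr (a - 1) * ?Y x) \<longlongrightarrow> 1) at_top"
    by (rule Lim_transform_eventually)
       (use eventually_gt_at_top[of 0] in \<open>eventually_elim, simp add: powr_diff field_simps\<close>)
qed

text \<open>The integral representation at \<open>a + 1\<close> has second parameter
  \<open>b + 1\<close>, and that integral is exactly the one appearing in
  \<open>a_minus_xp\<close>.\<close>

lemma tricomi_upper: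
  assumes "x > 0"
  shows "tricomi (a + 1) c x = (a - x * p x) / (a * b) * U x"
proof -
  interpret up: tricomi_parameters "a + 1" c
    using a_pos c_less by unfold_locales auto
  have "tricomi (a + 1) c x = tricomi_integral (a+1) (b+1) x / Gamma (a + 1)"
    using up.tricomi_eq[OF assms] unfolding up.U_def up.b_def b_def by (simp add: diff_add_eq add.assoc)
  moreover have "Gamma (a + 1) = a * Gamma a" using a_pos Gamma_plus1[of a] by (simp add: nonpos_Ints_def)
  ultimately show ?thesis
    unfolding a_minus_xp[OF assms] U_def using tricomi_integral_nz[OF assms] b_pos a_pos Gamma_real_pos[OF a_pos]
    by (simp add: field_simps)
qed

lemma turanian_eq:
  assumes "x > 0"
  shows "(tricomi a c x)\<^sup>2 - tricomi (a - 1) c x * tricomi (a + 1) c x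
    = (1 - x * v x / a) / b * (tricomi a c x)\<^sup>2"
proof -
  have "a * b - (x + a - c + x * p x) * (a - x * p x) = a - x * v x"
    by (simp add: v_def b_def algebra_simps power2_eq_square)
  then have "1 - (x + a - c + x * p x) * ((a - x * p x) / (a * b)) = (1 - x * v x / a) / b"
    using a_pos b_pos by (simp add: field_simps)
  then have "(1 - (x + a - c + x * p x) * ((a - x * p x) / (a * b))) * (U x)\<^sup>2
     = (1 - x * v x / a) / b * (U x)\<^sup>2" by simp
  moreover have "(U x)\<^sup>2 - A * U x * (B * U x) = (1 - A * B) * (U x)\<^sup>2" for A B
    by (simp add: algebra_simps power2_eq_square)
  ultimately show ?thesis
    unfolding tricomi_eq[OF assms] tricomi_lower[OF assms] tricomi_upper[OF assms] by (simp only:)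
qed

lemma tricomi_sq_pos: "x > 0 \<Longrightarrow> (tricomi a c x)\<^sup>2 > 0"
  using tricomi_eq[of x] U_pos[of x] by simp

end

section \<open>The inequalities\<close>

context tricomi_parameters
begin

text \<open>The Turanian quotient splits as (a - x p)/(a b) + x (p - v)/(a b). The first summand is
  below 1/x by \<open>x_a_minus_xp_less\<close>; \<open>d\<close> is the gap between 1/x and the
  second.\<close>

lemma turanian_less:
  assumes c: "c < 1" and x: "x > 0"
  shows "(tricomi a c x)\<^sup>2 - tricomi (a - 1) c x * tricomi (a + 1) c x < 2 / x * (tricomi a c x)\<^sup>2"
proof -
  define d where "d = (\<lambda>x. 1 / x - x * (p x - v x) / (a * b))"
  define m where "m = (\<lambda>x. x - c + 2 + 2 * (x * p x))"
  define \<delta> where "\<delta> = (\<lambda>x. - 1 / x - m x / x + x * p x * (1 - c + x * p x) / (a * b))"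
  define w where "w = (\<lambda>x. ((x - c + 2 * x * p x) * v x - x * (p x + (p x)\<^sup>2)) / x)"
  have "d x > 0"
  proof (rule barrier_pos[where d = d and x = x and l = 0 and m = m and \<delta> = \<delta>])
    fix x :: real assume x: "x > 0"
    show "(d has_real_derivative
        - 1 / x\<^sup>2 - ((p x - v x) + x * (- v x / x - w x)) / (a * b)) (at x)"
      unfolding d_def w_def using x a_pos b_pos p_deriv[OF x] v_deriv[OF x]
      by (auto intro!: derivative_eq_intros simp: power2_eq_square)
    have xw: "x * w x = (x - c + 2 * x * p x) * v x - x * (p x + (p x)\<^sup>2)"
      using x by (simp add: w_def)
    have "x * (- 1 / x\<^sup>2 - ((p x - v x) + x * (- v x / x - w x)) / (a * b))
      = - 1 / x - x * (p x - v x - v x - x * w x) / (a * b)"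
      using x by (simp add: right_diff_distrib power2_eq_square)
    also have "p x - v x - v x - x * w x
      = m x * (p x - v x) - p x * (1 - c + x * p x)"
      unfolding xw m_def by (simp add: algebra_simps power2_eq_square)
    also have "- 1 / x - x * (m x * (p x - v x) - p x * (1 - c + x * p x)) / (a * b) = \<delta> x + m x * d x"
      unfolding \<delta>_def d_def using a_pos b_pos x by (simp add: field_simps)
    finally show "x * (- 1 / x\<^sup>2 - ((p x - v x) + x * (- v x / x - w x)) / (a * b)) = \<delta> x + m x * d x" .
    have xp: "0 < x * p x" "x * p x < a" using x p_pos[OF x] xp_less[OF x] by auto
    show "m x \<ge> 0" using xp x c by (simp add: m_def)
    \<comment> \<open>From 0 < x p < a and 0 < 1 - c + x p < b. The positive term of
      \<open>\<delta>\<close> is thus below 1, which -m/x \<le> -1 outweighs.\<close>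
    have "x * p x * (1 - c + x * p x) < a * b"
      using xp c by (intro mult_strict_mono) (auto simp: b_def)
    then have "x * p x * (1 - c + x * p x) / (a * b) < 1" using a_pos b_pos by simp
    moreover have "1 \<le> m x / x" using x xp c by (simp add: m_def field_simps)
    moreover have "- 1 / x < 0" using x by simp
    ultimately show "\<delta> x < 0" unfolding \<delta>_def by linarith
  next
    have "((\<lambda>x. 1 / x - (x * p x - x * v x) / (a * b)) \<longlongrightarrow> 0 - (a - a) / (a * b)) at_top"
      using a_pos b_pos by (intro tendsto_diff tendsto_divide xp_lim xv_lim tendsto_const) (real_asymp | simp)+
    then show "(d \<longlongrightarrow> 0) at_top" by (simp add: d_def right_diff_distrib)
  qed (use x in auto)
  then have "x * (p x - v x) / (a * b) < 1 / x" by (simp add: d_def)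
  moreover have "(a - x * p x) / (a * b) < 1 / x"
    using x_a_minus_xp_less[OF x] x a_pos b_pos by (simp add: field_simps)
  moreover have "(1 - x * v x / a) / b = (a - x * p x) / (a * b) + x * (p x - v x) / (a * b)"
    using a_pos b_pos by (simp add: field_simps)
  ultimately have "(1 - x * v x / a) / b < 2 / x" by simp
  then show ?thesis unfolding turanian_eq[OF x] by (intro mult_strict_right_mono tricomi_sq_pos x)
qed

text \<open>The constant is the value of p at 0+, the root of a + c p = 0 left by the Riccati
  equation at x = 0. Inserting it into that equation leaves only negative terms in
  \<open>\<delta>\<close>.\<close>

lemma p_less:
  assumes "c < 0" "x > 0"
  shows "p x < a / (- c)"
proof -
  have "a / (- c) - p x > 0"
  proof (rule barrier_pos[where d = "\<lambda>x. a / (- c) - p x" and x = x and l = "a / (- c)" and m = "\<lambda>x. x - c"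
        and \<delta> = "\<lambda>x. - (x * (a / (- c))) - x * (p x)\<^sup>2"])
    fix x :: real assume x: "x > 0"
    show "((\<lambda>x. a / (- c) - p x) has_real_derivative v x / x) (at x)"
      using p_deriv[OF x] by (auto intro!: derivative_eq_intros)
    show "x * (v x / x) = - (x * (a / (- c))) - x * (p x)\<^sup>2 + (x - c) * (a / (- c) - p x)"
      using x assms by (simp add: v_def field_simps)
    have "0 < x * (a / (- c))" "0 \<le> x * (p x)\<^sup>2" using x a_pos assms by (auto simp: divide_less_0_iff mult_less_0_iff)
    then show "- (x * (a / (- c))) - x * (p x)\<^sup>2 < 0" by linarith
    show "0 \<le> x - c" using x assms by simp
  next
    have "((\<lambda>x. a / (- c) - p x) \<longlongrightarrow> a / (- c) - 0) at_top"
      by (intro tendsto_diff p_lim tendsto_const)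
    then show "((\<lambda>x. a / (- c) - p x) \<longlongrightarrow> a / (- c)) at_top" by simp
    show "0 \<le> a / (- c)" using a_pos assms by (simp add: divide_nonneg_neg)
  qed (use assms in auto)
  then show ?thesis by simp
qed

text \<open>The constant is half the bound on \<open>p\<close>: this is what lets the term 2 x p in
  \<open>m\<close> absorb x p^2 when the equation for \<open>v\<close> is compared with a
  constant.\<close>

lemma v_less:
  assumes "c < 0" "x > 0"
  shows "v x < a / (2 * (- c))"
proof -
  let ?A = "a / (2 * (- c))"
  define m where "m = (\<lambda>x. x - c + 2 * x * p x)"
  define \<delta> where "\<delta> = (\<lambda>x. - (m x * ?A) + x * (p x + (p x)\<^sup>2))"
  have "?A - v x > 0"
  proof (rule barrier_pos[where d = "\<lambda>x. ?A - v x" and x = x and l = ?A and m = m and \<delta> = \<delta>])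
    fix x :: real assume x: "x > 0"
    show "((\<lambda>x. ?A - v x) has_real_derivative
        - (((x - c + 2 * x * p x) * v x - x * (p x + (p x)\<^sup>2)) / x)) (at x)"
      using DERIV_diff[OF DERIV_const[of ?A] v_deriv[OF x]] by simp
    show "x * - (((x - c + 2 * x * p x) * v x - x * (p x + (p x)\<^sup>2)) / x) = \<delta> x + m x * (?A - v x)"
    proof -
      have e: "x * - (N / x) = - N" for N using x by simp
      show ?thesis unfolding e by (simp add: \<delta>_def m_def right_diff_distrib)
    qed
    show "m x \<ge> 0" using x p_pos[OF x] assms by (simp add: m_def)
    have xp: "0 < x * p x" "x * p x < a" using x p_pos[OF x] xp_less[OF x] by auto
    have pA: "p x < 2 * ?A" using p_less[OF assms(1) x] by simp
    \<comment> \<open>Averaging this with x p < a gives x p < x A + a/2 for A = \<open>?A\<close>,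
      and a/2 = -c A. The next estimate covers x p^2.\<close>
    have "x * p x < x * (2 * ?A)" using pA x by (intro mult_strict_left_mono)
    moreover have "x * p x * p x < x * p x * (2 * ?A)" using pA xp by (intro mult_strict_left_mono)
    moreover have "- c * ?A = a / 2" using assms by simp
    moreover have "m x * ?A = x * ?A + (- c * ?A) + x * p x * (2 * ?A)"
      unfolding m_def by (simp only: distrib_right left_diff_distrib) (simp add: mult_ac)
    ultimately show "\<delta> x < 0"
      using xp unfolding \<delta>_def power2_eq_square distrib_left mult.assoc[symmetric] by linarith
  next
    have "((\<lambda>x. ?A - v x) \<longlongrightarrow> ?A - 0) at_top"
      by (intro tendsto_diff v_lim tendsto_const)
    then show "((\<lambda>x. ?A - v x) \<longlongrightarrow> ?A) at_top" by simp
    show "0 \<le> ?A" using a_pos assms by (simp add: divide_nonneg_neg)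
  qed (use assms in auto)
  then show ?thesis by simp
qed

lemma turanian_greater_linear:
  assumes "c < 0" "x > 0"
  shows "1 / (1 + a - c) * (1 + 1 / (2 * c) * x) * (tricomi a c x)\<^sup>2
    < (tricomi a c x)\<^sup>2 - tricomi (a - 1) c x * tricomi (a + 1) c x"
proof -
  have "x * v x / a < x * (a / (2 * (- c))) / a"
    using v_less[OF assms] assms a_pos by (intro divide_strict_right_mono mult_strict_left_mono)
  also have "\<dots> = - (1 / (2 * c) * x)" using a_pos assms by (simp add: field_simps)
  finally have "(1 + 1 / (2 * c) * x) / b < (1 - x * v x / a) / b"
    using b_pos by (intro divide_strict_right_mono) auto
  then have "(1 + 1 / (2 * c) * x) / b * (tricomi a c x)\<^sup>2 < (1 - x * v x / a) / b * (tricomi a c x)\<^sup>2"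
    by (intro mult_strict_right_mono tricomi_sq_pos assms)
  then show ?thesis unfolding turanian_eq[OF assms(2)] by (simp add: b_def)
qed

text \<open>The coefficient of x is the slope s of v at 0+: inserting v = s x and p = a / (-c) into
  the equation for v at leading order gives (-c - 1) s = p + p^2. The barrier is therefore applied
  to v / x.\<close>

lemma v_less_quadratic:
  assumes c: "c < -1" and x: "x > 0"
  shows "v x < a * ((c - a) / (c\<^sup>2 * (c + 1))) * x"
proof -
  let ?k = "(c - a) / (c\<^sup>2 * (c + 1))"
  have k: "(- c - 1) * (a * ?k) = a / (- c) + (a / (- c))\<^sup>2"
  proof -
    have "(- c - 1) * (a * ?k) = a * (a - c) / c\<^sup>2"
      using c by (simp add: divide_simps) algebra
    also have "\<dots> = a / (- c) + (a / (- c))\<^sup>2"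
      using c by (simp add: field_simps power2_eq_square)
    finally show ?thesis .
  qed
  have "0 < a / (- c)" using c a_pos by (simp add: divide_pos_neg)
  then have "0 < (- c - 1) * (a * ?k)" unfolding k by (intro add_pos_nonneg zero_le_power2)
  then have kpos: "a * ?k > 0" by (rule zero_less_mult_pos) (use c in simp)
  \<comment> \<open>Dividing \<open>v\<close> by \<open>x\<close> lowers its coefficient by 1, so -c
    becomes -c - 1, which is positive because c < -1.\<close>
  define m where "m = (\<lambda>x. x - c - 1 + 2 * x * p x)"
  define \<delta> where "\<delta> = (\<lambda>x. p x + (p x)\<^sup>2 - m x * (a * ?k))"
  define w where "w = (\<lambda>x. ((x - c + 2 * x * p x) * v x - x * (p x + (p x)\<^sup>2)) / x)"
  have "a * ?k - v x / x > 0"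
  proof (rule barrier_pos[where d = "\<lambda>x. a * ?k - v x / x" and x = x and l = "a * ?k" and m = m and \<delta> = \<delta>])
    fix x :: real assume x: "x > 0"
    show "((\<lambda>x. a * ?k - v x / x) has_real_derivative - ((w x * x - v x * 1) / (x * x))) (at x)"
      unfolding w_def using v_deriv[OF x] x by (auto intro!: derivative_eq_intros)
    have "x * - ((w x * x - v x * 1) / (x * x)) = v x / x - w x"
      using x by (simp add: field_simps)
    also have "v x / x - w x = \<delta> x + m x * (a * ?k - v x / x)"
    proof -
      have "s - ((y + r) * s - P) = P - (y - 1 + r) * K + (y - 1 + r) * (K - s)" for s y r P K :: real
        by (simp add: algebra_simps)
      moreover have "w x = (x - c + 2 * x * p x) * (v x / x) - (p x + (p x)\<^sup>2)"
        unfolding w_def using x by (simp add: diff_divide_distrib)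
      ultimately show ?thesis unfolding \<delta>_def m_def by (simp only:)
    qed
    finally show "x * - ((w x * x - v x * 1) / (x * x)) = \<delta> x + m x * (a * ?k - v x / x)" .
    have xp: "x * p x > 0" using x p_pos[OF x] by simp
    show "m x \<ge> 0" using x c xp by (simp add: m_def)
    have "p x < a / (- c)" using p_less[of x] c x by simp
    moreover have "(p x)\<^sup>2 < (a / (- c))\<^sup>2"
      using calculation p_pos[OF x] by (intro power_strict_mono) auto
    ultimately have "p x + (p x)\<^sup>2 < (- c - 1) * (a * ?k)" unfolding k by simp
    also have "\<dots> \<le> m x * (a * ?k)"
      using kpos xp x by (intro mult_right_mono) (auto simp: m_def)
    finally show "\<delta> x < 0" by (simp add: \<delta>_def)
  next
    have "((\<lambda>x. a * ?k - v x * (1 / x)) \<longlongrightarrow> a * ?k - 0 * 0) at_top"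
      by (intro tendsto_diff tendsto_mult[OF v_lim] tendsto_const) real_asymp
    then show "((\<lambda>x. a * ?k - v x / x) \<longlongrightarrow> a * ?k) at_top" by simp
  qed (use kpos x in auto)
  then show ?thesis using x by (simp add: field_simps)
qed

lemma turanian_greater_quadratic:
  assumes c: "c < -1" and x: "x > 0"
  shows "1 / (1 + a - c) * (1 - (c - a) / (c\<^sup>2 * (c + 1)) * x\<^sup>2) * (tricomi a c x)\<^sup>2
    < (tricomi a c x)\<^sup>2 - tricomi (a - 1) c x * tricomi (a + 1) c x"
proof -
  let ?k = "(c - a) / (c\<^sup>2 * (c + 1))"
  have "x * v x / a < x * (a * ?k * x) / a"
    using v_less_quadratic[OF assms] x a_pos by (intro divide_strict_right_mono mult_strict_left_mono)
  also have "x * (a * k * x) / a = k * x\<^sup>2" for k using a_pos by (simp add: power2_eq_square)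
  finally have "(1 - ?k * x\<^sup>2) / b < (1 - x * v x / a) / b"
    using b_pos by (intro divide_strict_right_mono) auto
  then have "(1 - ?k * x\<^sup>2) / b * (tricomi a c x)\<^sup>2 < (1 - x * v x / a) / b * (tricomi a c x)\<^sup>2"
    by (intro mult_strict_right_mono tricomi_sq_pos x)
  then show ?thesis unfolding turanian_eq[OF x] by (simp add: b_def)
qed

section \<open>Sharpness at the endpoints\<close>

text \<open>Since p lies between 0 and a / (-c), v stays bounded near 0, and the factor x does the
  rest.\<close>

lemma xv_lim_at_right:
  assumes "c < 0"
  shows "((\<lambda>x. x * v x) \<longlongrightarrow> 0) (at_right 0)"
proof (rule Lim_null_comparison)
  let ?P = "a / (- c)"
  show "((\<lambda>x. x * a + (x * x + x * \<bar>c\<bar>) * ?P + x * x * ?P\<^sup>2) \<longlongrightarrow> 0) (at_right 0)"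
    by real_asymp
  have "norm (x * v x) \<le> x * a + (x * x + x * \<bar>c\<bar>) * ?P + x * x * ?P\<^sup>2" if x: "x > 0" for x
  proof -
    have p: "0 < p x" "p x < ?P" using p_pos[OF x] p_less[OF assms x] by auto
    have "\<bar>v x\<bar> \<le> a + \<bar>x - c\<bar> * p x + x * (p x)\<^sup>2"
    proof -
      have "\<bar>(x - c) * p x\<bar> = \<bar>x - c\<bar> * p x" "0 \<le> x * (p x)\<^sup>2" using p x by (auto simp: abs_mult)
      then show ?thesis unfolding v_def using a_pos by linarith
    qed
    also have "\<dots> \<le> a + (x + \<bar>c\<bar>) * ?P + x * ?P\<^sup>2"
      using p x by (intro add_mono mult_mono power_mono order_refl) auto
    finally have "x * \<bar>v x\<bar> \<le> x * (a + (x + \<bar>c\<bar>) * ?P + x * ?P\<^sup>2)"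
      using x by (intro mult_left_mono) auto
    also have "x * (a + (x + \<bar>c\<bar>) * P + x * P\<^sup>2) = x * a + (x * x + x * \<bar>c\<bar>) * P + x * x * P\<^sup>2" for P
      by (simp add: algebra_simps)
    finally show ?thesis using x by (simp only: abs_mult real_norm_def abs_of_pos)
  qed
  then show "eventually (\<lambda>x. norm (x * v x) \<le> x * a + (x * x + x * \<bar>c\<bar>) * ?P + x * x * ?P\<^sup>2) (at_right 0)"
    by (auto simp: eventually_at_filter)
qed

text \<open>The condition on \<open>F\<close> says that x > 0 eventually, so one statement serves
  both endpoints.\<close>

lemma turanian_ratio_lim:
  assumes "F \<le> principal {0<..}" and "((\<lambda>x. x * v x) \<longlongrightarrow> l) F"
  shows "((\<lambda>x. ((tricomi a c x)\<^sup>2 - tricomi (a - 1) c x * tricomi (a + 1) c x) / (tricomi a c x)\<^sup>2)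
    \<longlongrightarrow> (1 - l / a) / b) F"
proof -
  have "((\<lambda>x. (1 - x * v x / a) / b) \<longlongrightarrow> (1 - l / a) / b) F"
    using a_pos b_pos by (intro tendsto_intros assms) auto
  moreover have "eventually (\<lambda>x. x \<in> {0<..}) F"
    using assms(1) by (simp add: le_principal)
  then have "eventually (\<lambda>x. (1 - x * v x / a) / b =
      ((tricomi a c x)\<^sup>2 - tricomi (a - 1) c x * tricomi (a + 1) c x) / (tricomi a c x)\<^sup>2) F"
    by eventually_elim (use turanian_eq tricomi_sq_pos in fastforce)
  ultimately show ?thesis by (rule Lim_transform_eventually)
qed

lemma weight_ratio_lim:
  assumes "F \<le> principal {0<..}" and "(g \<longlongrightarrow> l) F"
  shows "((\<lambda>x. g x * (tricomi a c x)\<^sup>2 / (tricomi a c x)\<^sup>2) \<longlongrightarrow> l) F"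
proof -
  have "eventually (\<lambda>x. x \<in> {0<..}) F"
    using assms(1) by (simp add: le_principal)
  then have "eventually (\<lambda>x. g x = g x * (tricomi a c x)\<^sup>2 / (tricomi a c x)\<^sup>2) F"
    by eventually_elim (use tricomi_sq_pos in fastforce)
  with assms(2) show ?thesis by (rule Lim_transform_eventually)
qed

text \<open>The Turanian quotient tends to 1/b as x v tends to 0. The factor \<open>g\<close> is
  left general to cover both the linear and the quadratic lower bound.\<close>

lemma sharp_at_right:
  assumes "c < 0" and "(g \<longlongrightarrow> 1 / b) (at_right 0)"
  shows "sharp_relative (\<lambda>x. (tricomi a c x)\<^sup>2) (\<lambda>x. g x * (tricomi a c x)\<^sup>2)
    (\<lambda>x. (tricomi a c x)\<^sup>2 - tricomi (a - 1) c x * tricomi (a + 1) c x) (at_right 0)"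
proof -
  have "at_right (0::real) \<le> principal {0<..}" by (simp add: at_within_def)
  then show ?thesis
    unfolding sharp_relative_def
    using weight_ratio_lim[OF _ assms(2)] turanian_ratio_lim[OF _ xv_lim_at_right[OF assms(1)]]
    by auto
qed

text \<open>The common limit is 0: x v tends to a, so (1 - x v / a) / b vanishes at infinity, as
  does 2/x.\<close>

lemma sharp_at_top:
  "sharp_relative (\<lambda>x. (tricomi a c x)\<^sup>2)
    (\<lambda>x. (tricomi a c x)\<^sup>2 - tricomi (a - 1) c x * tricomi (a + 1) c x)
    (\<lambda>x. 2 / x * (tricomi a c x)\<^sup>2) at_top"
proof -
  have "at_top \<le> principal {0::real<..}" by (simp add: le_principal eventually_gt_at_top)
  moreover have "((\<lambda>x::real. 2 / x) \<longlongrightarrow> 0) at_top" by real_asymp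
  ultimately show ?thesis
    unfolding sharp_relative_def
    using weight_ratio_lim[of at_top "\<lambda>x. 2 / x" 0] turanian_ratio_lim[OF _ xv_lim] a_pos
    by auto
qed

end

theorem theorem2:
  "(\<forall>a c x :: real. a > 0 \<and> 0 > c \<and> x > 0 \<longrightarrow>
      1 / (1 + a - c) * (1 + 1 / (2 * c) * x) * (tricomi a c x)\<^sup>2
        < (tricomi a c x)\<^sup>2 - tricomi (a - 1) c x * tricomi (a + 1) c x \<and>
      (tricomi a c x)\<^sup>2 - tricomi (a - 1) c x * tricomi (a + 1) c x
        < 2 / x * (tricomi a c x)\<^sup>2) \<and>
   (\<forall>a c x :: real. a > 0 \<and> c < 1 \<and> x > 0 \<longrightarrow>
      (tricomi a c x)\<^sup>2 - tricomi (a - 1) c x * tricomi (a + 1) c x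
        < 2 / x * (tricomi a c x)\<^sup>2) \<and>
   (\<forall>a c x :: real. a > 1 \<and> c < -1 \<and> x > 0 \<longrightarrow>
      1 / (1 + a - c) * (1 - (c - a) / (c\<^sup>2 * (c + 1)) * x\<^sup>2) * (tricomi a c x)\<^sup>2
        < (tricomi a c x)\<^sup>2 - tricomi (a - 1) c x * tricomi (a + 1) c x) \<and>
   (\<forall>a c :: real. a > 0 \<and> 0 > c \<longrightarrow>
      sharp_relative (\<lambda>x. (tricomi a c x)\<^sup>2)
        (\<lambda>x. 1 / (1 + a - c) * (1 + 1 / (2 * c) * x) * (tricomi a c x)\<^sup>2)
        (\<lambda>x. (tricomi a c x)\<^sup>2 - tricomi (a - 1) c x * tricomi (a + 1) c x)
        (at_right 0)) \<and>
   (\<forall>a c :: real. a > 1 \<and> c < -1 \<longrightarrow>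
      sharp_relative (\<lambda>x. (tricomi a c x)\<^sup>2)
        (\<lambda>x. 1 / (1 + a - c) * (1 - (c - a) / (c\<^sup>2 * (c + 1)) * x\<^sup>2) * (tricomi a c x)\<^sup>2)
        (\<lambda>x. (tricomi a c x)\<^sup>2 - tricomi (a - 1) c x * tricomi (a + 1) c x)
        (at_right 0)) \<and>
   (\<forall>a c :: real. a > 0 \<and> c < 1 \<longrightarrow>
      sharp_relative (\<lambda>x. (tricomi a c x)\<^sup>2)
        (\<lambda>x. (tricomi a c x)\<^sup>2 - tricomi (a - 1) c x * tricomi (a + 1) c x)
        (\<lambda>x. 2 / x * (tricomi a c x)\<^sup>2)
        at_top)"
proof (intro conjI allI impI; elim conjE)
  fix a c x :: real assume "a > 0" "0 > c" "x > 0"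
  interpret tricomi_parameters a c using \<open>a > 0\<close> \<open>0 > c\<close> by unfold_locales auto
  show "1 / (1 + a - c) * (1 + 1 / (2 * c) * x) * (tricomi a c x)\<^sup>2
        < (tricomi a c x)\<^sup>2 - tricomi (a - 1) c x * tricomi (a + 1) c x"
    by (rule turanian_greater_linear) fact+
  show "(tricomi a c x)\<^sup>2 - tricomi (a - 1) c x * tricomi (a + 1) c x < 2 / x * (tricomi a c x)\<^sup>2"
    using \<open>0 > c\<close> \<open>x > 0\<close> by (intro turanian_less) auto
next
  fix a c x :: real assume "a > 0" "c < 1" "x > 0"
  interpret tricomi_parameters a c using \<open>a > 0\<close> \<open>c < 1\<close> by unfold_locales auto
  show "(tricomi a c x)\<^sup>2 - tricomi (a - 1) c x * tricomi (a + 1) c x < 2 / x * (tricomi a c x)\<^sup>2"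
    by (rule turanian_less) fact+
next
  fix a c x :: real assume "a > 1" "c < -1" "x > 0"
  interpret tricomi_parameters a c using \<open>a > 1\<close> \<open>c < -1\<close> by unfold_locales auto
  show "1 / (1 + a - c) * (1 - (c - a) / (c\<^sup>2 * (c + 1)) * x\<^sup>2) * (tricomi a c x)\<^sup>2
        < (tricomi a c x)\<^sup>2 - tricomi (a - 1) c x * tricomi (a + 1) c x"
    by (rule turanian_greater_quadratic) fact+
next
  fix a c :: real assume "a > 0" "0 > c"
  interpret tricomi_parameters a c using \<open>a > 0\<close> \<open>0 > c\<close> by unfold_locales auto
  have "((\<lambda>x. 1 / (1 + a - c) * (1 + 1 / (2 * c) * x)) \<longlongrightarrow> 1 / (1 + a - c) * (1 + 1 / (2 * c) * 0)) (at_right 0)"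
    by (intro tendsto_intros)
  then show "sharp_relative (\<lambda>x. (tricomi a c x)\<^sup>2)
        (\<lambda>x. 1 / (1 + a - c) * (1 + 1 / (2 * c) * x) * (tricomi a c x)\<^sup>2)
        (\<lambda>x. (tricomi a c x)\<^sup>2 - tricomi (a - 1) c x * tricomi (a + 1) c x) (at_right 0)"
    using \<open>0 > c\<close> by (intro sharp_at_right) (simp_all add: b_def)
next
  fix a c :: real assume "a > 1" "c < -1"
  interpret tricomi_parameters a c using \<open>a > 1\<close> \<open>c < -1\<close> by unfold_locales auto
  have "((\<lambda>x. 1 / (1 + a - c) * (1 - (c - a) / (c\<^sup>2 * (c + 1)) * x\<^sup>2))
      \<longlongrightarrow> 1 / (1 + a - c) * (1 - (c - a) / (c\<^sup>2 * (c + 1)) * 0\<^sup>2)) (at_right 0)"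
    by (intro tendsto_intros)
  then show "sharp_relative (\<lambda>x. (tricomi a c x)\<^sup>2)
        (\<lambda>x. 1 / (1 + a - c) * (1 - (c - a) / (c\<^sup>2 * (c + 1)) * x\<^sup>2) * (tricomi a c x)\<^sup>2)
        (\<lambda>x. (tricomi a c x)\<^sup>2 - tricomi (a - 1) c x * tricomi (a + 1) c x) (at_right 0)"
    using \<open>c < -1\<close> by (intro sharp_at_right) (simp_all add: b_def)
next
  fix a c :: real assume "a > 0" "c < 1"
  interpret tricomi_parameters a c using \<open>a > 0\<close> \<open>c < 1\<close> by unfold_locales auto
  show "sharp_relative (\<lambda>x. (tricomi a c x)\<^sup>2)
        (\<lambda>x. (tricomi a c x)\<^sup>2 - tricomi (a - 1) c x * tricomi (a + 1) c x)
        (\<lambda>x. 2 / x * (tricomi a c x)\<^sup>2) at_top"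
    by (rule sharp_at_top)
qed

end
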